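(* Let $m>3$ be an odd number not divisible by $3$. If any of the residues $-1$, $-2$, $2$, $3$ modulo $m$ belongs to $G_m$, then $m$ is complete. If moreover $m>12$ and any of the residues $5,6,7,8,9,10,11,12$ modulo $m$ belongs to $G_m$, then $m$ is complete.
   Context: Let $\mu$ be the unique Borel probability measure on $\mathbb{R}$ satisfying $\mu(E)=\frac12\left(\mu(\tau_0^{-1}E)+\mu(\tau_2^{-1}E)\right)$ for all Borel sets $E$, where $\tau_0(x)=x/4$, $\tau_2(x)=(x+2)/4$. For odd $m\in\mathbb{N}$ let $\Gamma(m)=\{\sum_{k=0}^n 4^k l_k : l_k\in\{0,m\}, n\in\mathbb{N}\}$; $m$ is complete if $\{e^{2\pi i\lambda x}:\lambda\in\Gamma(m)\}$ is an orthonormal basis of $L^2(\mu)$, incomplete otherwise. (Known fact from prior work: $m$ is complete iff the only extreme cycle for the digits $\{0,m\}$ is $\{0\}$, where a finite set $\{x_0,\dots,x_{r-1}\}\subset\mathbb{R}$ is an extreme cycle for $\{0,m\}$ if there are $l_0,\dots,l_{r-1}\in\{0,m\}$ with $x_{k+1}=(x_k+l_k)/4$ for $0\le k\le r-2$, $x_0=(x_{r-1}+l_{r-1})/4$, and $\left|\frac{1+e^{2\pi i\cdot 2x_k}}{2}\right|=1$ for all $k$.) $U(\mathbb{Z}_m)$ denotes the group of units of $\mathbb{Z}/m\mathbb{Z}$ and $G_m=\{4^j \bmod m : j=0,1,2,\dots\}$ is the subgroup generated by $4$. *)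

theory Defs
  imports "HOL-Probability.Probability"
begin

(* The tau-preimages are taken in the whole real line; space M = UNIV follows from the sets condition. *)
definition cantor4_measure :: "real measure \<Rightarrow> bool" where
  "cantor4_measure M \<longleftrightarrow> prob_space M \<and> sets M = sets borel \<and>
     (\<forall>E \<in> sets borel. measure M E =
        (1/2) * (measure M ((\<lambda>x. x / 4) -` E) + measure M ((\<lambda>x. (x + 2) / 4) -` E)))"

definition L2_fun :: "'a measure \<Rightarrow> ('a \<Rightarrow> complex) \<Rightarrow> bool" where
  "L2_fun M f \<longleftrightarrow> f \<in> borel_measurable M \<and> integrable M (\<lambda>x. (norm (f x))\<^sup>2)"

definition L2_inner :: "'a measure \<Rightarrow> ('a \<Rightarrow> complex) \<Rightarrow> ('a \<Rightarrow> complex) \<Rightarrow> complex" where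
  "L2_inner M f g = (\<integral>x. f x * cnj (g x) \<partial>M)"

definition L2_dist :: "'a measure \<Rightarrow> ('a \<Rightarrow> complex) \<Rightarrow> ('a \<Rightarrow> complex) \<Rightarrow> real" where
  "L2_dist M f g = sqrt (\<integral>x. (norm (f x - g x))\<^sup>2 \<partial>M)"

(* An orthonormal family in L^2(M) whose finite linear span is dense. Working with square-integrable
   functions instead of almost-everywhere classes is harmless, since L2_inner and L2_dist only
   depend on the classes. *)
definition orthonormal_basis_L2 :: "'a measure \<Rightarrow> 'i set \<Rightarrow> ('i \<Rightarrow> 'a \<Rightarrow> complex) \<Rightarrow> bool" where
  "orthonormal_basis_L2 M I e \<longleftrightarrow>
     (\<forall>i\<in>I. L2_fun M (e i)) \<and>
     (\<forall>i\<in>I. \<forall>j\<in>I. L2_inner M (e i) (e j) = (if i = j then 1 else 0)) \<and>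
     (\<forall>f. L2_fun M f \<longrightarrow>
        (\<forall>\<epsilon>>0. \<exists>J c. finite J \<and> J \<subseteq> I \<and> L2_dist M f (\<lambda>x. \<Sum>j\<in>J. c j * e j x) < \<epsilon>))"

definition Gamma_set :: "nat \<Rightarrow> nat set" where
  "Gamma_set m = {(\<Sum>k=0..n. 4 ^ k * l k) | n l. \<forall>k\<le>n. l k \<in> {0, m}}"

definition exponential :: "nat \<Rightarrow> real \<Rightarrow> complex" where
  "exponential n x = exp (2 * of_real pi * \<i> * of_nat n * of_real x)"

definition complete_number :: "real measure \<Rightarrow> nat \<Rightarrow> bool" where
  "complete_number M m \<longleftrightarrow> orthonormal_basis_L2 M (Gamma_set m) exponential"

(* Residue classes modulo m are represented by their least nonnegative representatives. *)
definition G_subgroup :: "nat \<Rightarrow> int set" where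
  "G_subgroup m = {4 ^ j mod int m | j :: nat. True}"

end

theory Submission
  imports Defs "HOL-Number_Theory.Residues"
begin

text \<open>The Fourier transform of the measure satisfies
  \<open>|\<mu>^(4s)|\<^sup>2 = cos\<^sup>2(2\<pi>s) |\<mu>^(s)|\<^sup>2\<close>. Hence the exponentials are orthonormal, and
  \<open>h(t) = \<Sum>\<lambda>\<in>\<Gamma>(m). |\<mu>^(t + \<lambda>)|\<^sup>2\<close> is a fixed point of the transfer operator with weights
  \<open>(1 \<plusminus> cos(\<pi>t))/2\<close> and branches \<open>t/4\<close>, \<open>(t + m)/4\<close>. Every exponential lies in the closed span once
  \<open>h \<ge> 1\<close> everywhere, and exponentials are dense by Stone-Weierstrass. If \<open>h\<close> has a minimum below 1
  on an invariant interval, the set of minimisers is closed (\<open>h\<close> is lower semicontinuous), is mapped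
  into itself by every branch of positive weight, and omits 0. A non-integral minimiser \<open>t\<close> would give
  minimisers \<open>t/4\<^sup>n\<close>, converging to 0; so the minimisers are integers \<open>k\<close>, each with \<open>k/4\<close> or
  \<open>(k + m)/4\<close> again a minimiser. Consequently all residues of \<open>4\<^sup>j k\<close> modulo \<open>m\<close> lie strictly
  between 0 and \<open>m/3\<close>. Some such residue lies in \<open>[m/16, m/12)\<close>, and multiplying it (or a related
  one) by the given \<open>r\<close> leaves \<open>(0, m/3)\<close>.\<close>

section \<open>Residues in the lowest third\<close>

text \<open>On \<open>S\<close> the map \<open>4 * x mod m\<close> is either \<open>4 * x\<close>,
  which forces \<open>12 * x < m\<close> because the image is again below a third, or
  \<open>4 * x - m\<close>. The minimum of \<open>S\<close> cannot take the second branch, as its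
  image would be smaller. The largest element below a twelfth then has its fourfold in
  \<open>S\<close> but above a twelfth, so this fourfold takes the second branch, giving
  \<open>m \<le> 16 * x\<close>.\<close>

lemma exists_in_sixteenth_twelfth:
  fixes m :: int and S :: "int set"
  assumes "S \<noteq> {}"
    and bounds: "\<And>x. x \<in> S \<Longrightarrow> 0 < x \<and> 3 * x < m"
    and times4: "\<And>x. x \<in> S \<Longrightarrow> 4 * x mod m \<in> S"
  obtains x where "x \<in> S" "m \<le> 16 * x" "12 * x < m"
proof -
  have "finite S"
    by (rule finite_subset[of _ "{0..m}"]) (use bounds in fastforce)+
  have step: "(12 * x < m \<and> 4 * x \<in> S) \<or> (m \<le> 4 * x \<and> 4 * x - m \<in> S)" if "x \<in> S" for x
  proof (cases "4 * x < m")
    case True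
    then have "4 * x mod m = 4 * x" using bounds[OF that] by simp
    then show ?thesis using times4[OF that] bounds[of "4 * x"] by auto
  next
    case False
    have "4 * x mod m = (4 * x - m) mod m" by simp
    also have "\<dots> = 4 * x - m" using False bounds[OF that] by (intro mod_pos_pos_trivial) auto
    finally show ?thesis using False times4[OF that] by auto
  qed
  define T where "T = {x \<in> S. 12 * x < m}"
  have "Min S \<in> T"
  proof (rule ccontr)
    assume "Min S \<notin> T"
    moreover have "Min S \<in> S" using \<open>finite S\<close> assms(1) by simp
    ultimately have "4 * Min S - m \<in> S" using step T_def by blast
    then have "Min S \<le> 4 * Min S - m" using \<open>finite S\<close> by simp
    then show False using bounds[OF \<open>Min S \<in> S\<close>] by simp
  qed
  moreover have "finite T" using \<open>finite S\<close> T_def by simp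
  ultimately have max: "Max T \<in> T" using Max_in by blast
  then have "0 < Max T" "4 * Max T \<in> S" using step[of "Max T"] bounds[of "Max T"] T_def by auto
  moreover have "4 * Max T \<notin> T"
    using Max_ge[OF \<open>finite T\<close>, of "4 * Max T"] \<open>0 < Max T\<close> by fastforce
  ultimately have "m \<le> 16 * Max T" using step[of "4 * Max T"] T_def by auto
  then show ?thesis using that[of "Max T"] max T_def by auto
qed

text \<open>With \<open>x\<close> in [m/16, m/12), the element \<open>4 * x\<close> lies in [m/4,
  m/3). For each admissible \<open>r\<close>, multiplying a suitable element of \<open>S\<close> by
  \<open>r\<close> lands in [m/3, m) modulo \<open>m\<close>.\<close>

lemma no_invariant_set_below_third:
  fixes m r :: int and S :: "int set"
  assumes "S \<noteq> {}"
    and bounds: "\<And>x. x \<in> S \<Longrightarrow> 0 < x \<and> 3 * x < m"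
    and times4: "\<And>x. x \<in> S \<Longrightarrow> 4 * x mod m \<in> S"
    and times_r: "\<And>x. x \<in> S \<Longrightarrow> r * x mod m \<in> S"
    and r: "r \<in> {-1, -2, 2, 3, 5, 6, 7, 8, 9, 10, 11, 12}"
  shows False
proof -
  have mod_ivl: "y mod m = y - k * m" if "k * m \<le> y" "y < k * m + m" for y k
  proof -
    have "y mod m = (y - k * m) mod m" by (simp add: mod_diff_eq[symmetric])
    also have "\<dots> = y - k * m" using that by (intro mod_pos_pos_trivial) auto
    finally show ?thesis .
  qed
  \<comment> \<open>Here \<open>k\<close> is the quotient of \<open>r * x\<close> by
    \<open>m\<close>, so a contradiction only requires linear inequalities.\<close>
  have bad: False if "x \<in> S" "m \<le> 3 * (r * x - k * m)" "r * x < k * m + m" "0 < m" for x k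
  proof -
    have "r * x mod m = r * x - k * m" by (rule mod_ivl) (use that in auto)
    then show False using bounds[OF times_r[OF that(1)]] that(2) by (metis linorder_not_less)
  qed
  obtain x where x: "x \<in> S" "m \<le> 16 * x" "12 * x < m"
    using exists_in_sixteenth_twelfth[OF assms(1) bounds times4] by blast
  have "4 * x mod m = 4 * x" using mod_ivl[of 0 "4 * x"] x bounds[of x] by simp
  then have x4: "4 * x \<in> S" using times4[OF x(1)] by simp
  have m: "0 < m" using bounds[OF x(1)] by simp
  show False
  proof (cases "r = 5")
    case True
    \<comment> \<open>For \<open>r = 5\<close> one multiplication does not suffice:
      \<open>5 * x\<close> lies in [5m/16, 5m/12) and may still be below a third. A second one puts
      \<open>25 * x\<close> in [25m/16, 5m/3), whose residue is at least 9m/16.\<close>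
    have "5 * x mod m = 5 * x" using mod_ivl[of 0 "5 * x"] x bounds[of x] by simp
    then have x5: "5 * x \<in> S" using times_r[OF x(1)] True by simp
    show False using bad[OF x5, of 1] True x m bounds[OF x5] by simp
  next
    case False
    then show False
      \<comment> \<open>For \<open>r\<close> from 6 to 12, \<open>r * x\<close> is in [3m/8, m). For
        \<open>r\<close> equal to 2 or 3, \<open>4 * x\<close> is used, with products in [m/2, m).
        For negative \<open>r\<close> the quotient is -1 and the residue exceeds 5m/6.\<close>
      using r x m bounds[OF x(1)] bounds[OF x4]
        bad[OF x(1), of 0] bad[OF x4, of 0] bad[OF x(1), of "-1"] by auto
  qed
qed

section \<open>The self-similar measure and its Fourier transform\<close>

text \<open>Approximation by simple functions. The limit case carries the bound by
  \<open>2 * norm (f x)\<close> so that dominated convergence applies; it serves both the integral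
  form of self-similarity and the density argument.\<close>

lemma borel_complex_induct:
  fixes f :: "real \<Rightarrow> complex"
  assumes f: "f \<in> borel_measurable borel"
    and ind: "\<And>A. A \<in> sets borel \<Longrightarrow> P (\<lambda>x. indicator A x)"
    and scale: "\<And>c g. P g \<Longrightarrow> P (\<lambda>x. c * g x)"
    and add: "\<And>g h. P g \<Longrightarrow> P h \<Longrightarrow> P (\<lambda>x. g x + h x)"
    and lim: "\<And>s. (\<And>i. P (s i)) \<Longrightarrow> (\<And>x. (\<lambda>i. s i x) \<longlonglongrightarrow> f x)
      \<Longrightarrow> (\<And>i x. norm (s i x) \<le> 2 * norm (f x)) \<Longrightarrow> P f"
  shows "P f"
proof -
  obtain s where s: "\<And>i. simple_function borel (s i)" "\<And>x. (\<lambda>i. s i x) \<longlonglongrightarrow> f x"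
      "\<And>i x. norm (s i x) \<le> 2 * norm (f x)"
    using borel_measurable_implies_sequence_metric[OF f, of 0] by auto
  have "P (s i)" for i
  proof -
    have fin: "finite (range (s i))"
      using s(1)[of i] by (simp add: simple_function_def)
    have meas: "s i -` {y} \<in> sets borel" for y
      using measurable_sets[OF borel_measurable_simple_function[OF s(1)], of "{y}" i] by simp
    have "P (\<lambda>x. \<Sum>y\<in>Y. y * indicator (s i -` {y}) x)" if "finite Y" for Y
      using that
    proof (induction Y)
      case empty
      show ?case using scale[OF ind[of "{}"], of 0] by simp
    next
      case (insert y Y)
      then show ?case
        using add[OF scale[OF ind[OF meas[of y]], of y] insert.IH]
        by (simp only: sum.insert[OF insert.hyps(1,2)])
    qed
    from this[OF fin] show ?thesis
    proof (rule back_subst[of P], intro ext)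
      fix x
      have "(\<Sum>y\<in>range (s i). y * indicator (s i -` {y}) x) = (\<Sum>y\<in>range (s i). if s i x = y then y else 0)"
        by (intro sum.cong) (auto simp: indicator_def)
      then show "(\<Sum>y\<in>range (s i). y * indicator (s i -` {y}) x) = s i x"
        using fin by (simp add: sum.delta')
    qed
  qed
  then show ?thesis using lim s by blast
qed

section \<open>Characters of the line and the Fourier transform of a distribution\<close>

definition wave :: "real \<Rightarrow> real \<Rightarrow> complex" where
  "wave s x = cis (2 * pi * s * x)"

lemma wave_measurable [measurable]: "wave s \<in> borel_measurable borel"
  unfolding wave_def cis.ctr
  by (intro borel_measurable_continuous_onI continuous_intros)

lemma norm_wave [simp]: "norm (wave s x) = 1"
  by (simp add: wave_def)

lemma wave_add: "wave (s + t) x = wave s x * wave t x"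
  by (simp add: wave_def cis_mult ring_distribs)

lemma cnj_wave: "cnj (wave s x) = wave (- s) x"
  by (simp add: wave_def cis_cnj)

lemma wave_diff: "wave (s - t) x = wave s x * cnj (wave t x)"
  using wave_add[of s "- t" x] by (simp add: cnj_wave)

lemma exponential_eq_wave: "exponential n = wave (real n)"
  by (rule ext) (simp add: exponential_def wave_def cis_conv_exp mult_ac)

locale cantor4 = real_distribution +
  assumes self_similar: "E \<in> sets borel \<Longrightarrow> measure M E =
    (measure M ((\<lambda>x. x / 4) -` E) + measure M ((\<lambda>x. (x + 2) / 4) -` E)) / 2"

lemma cantor4_measureD: "cantor4_measure M \<Longrightarrow> cantor4 M"
  unfolding cantor4_measure_def
  by (auto simp: cantor4_def cantor4_axioms_def real_distribution_def real_distribution_axioms_def)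

context real_distribution
begin

lemma integrable_bounded:
  fixes f :: "real \<Rightarrow> 'b::{banach, second_countable_topology}"
  assumes "f \<in> borel_measurable borel" "\<And>x. norm (f x) \<le> B"
  shows "integrable M f"
  using assms by (intro integrable_const_bound[of _ B]) auto

definition fourier :: "real \<Rightarrow> complex" where
  "fourier s = (\<integral>x. wave s x \<partial>M)"

lemma fourier_eq_char: "fourier s = char M (2 * pi * s)"
  by (simp add: fourier_def char_def wave_def cis_conv_exp mult_ac)

lemma fourier_0 [simp]: "fourier 0 = 1"
  by (simp add: fourier_eq_char char_zero)

lemma norm_fourier_le_1: "norm (fourier s) \<le> 1"
  by (simp add: fourier_eq_char cmod_char_le_1)

lemma continuous_on_fourier [continuous_intros]:
  assumes "continuous_on A f"
  shows "continuous_on A (\<lambda>x. fourier (f x))"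
proof -
  have "continuous_on UNIV (char M)"
    by (simp add: continuous_on_eq_continuous_at isCont_char)
  then show ?thesis unfolding fourier_eq_char
    by (rule continuous_on_compose2) (auto intro!: continuous_intros assms)
qed

lemma integrable_wave [simp]: "integrable M (wave s)"
  by (rule integrable_bounded[of _ 1]) auto

lemma cnj_fourier: "cnj (fourier s) = fourier (- s)"
  by (simp add: fourier_def cnj_wave flip: Bochner_Integration.integral_cnj)

lemma norm_fourier_minus: "norm (fourier (- s)) = norm (fourier s)"
  by (metis cnj_fourier complex_mod_cnj)

end

section \<open>Support of the measure and the scaling law of its transform\<close>

context cantor4
begin

text \<open>If the image of \<open>x\<close> under either branch has absolute value above
  \<open>a \<ge> 1\<close>, then \<open>x\<close> has absolute value above \<open>2 * a\<close>.
  Self-similarity thus bounds the tail at \<open>a\<close> by the tail at \<open>2 * a\<close>;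
  iterating from 1, the tail at 1 is bounded by tails tending to 0.\<close>

lemma AE_abs_le_1: "AE x in M. \<bar>x\<bar> \<le> 1"
proof -
  define p where "p a = prob {x. \<bar>x\<bar> > a}" for a
  have [measurable]: "{x. \<bar>x\<bar> > a} \<in> sets borel" for a :: real by measurable
  have le: "p a \<le> p (2 * a)" if "a \<ge> 1" for a
  proof -
    have "prob ((\<lambda>x. x / 4) -` {x. \<bar>x\<bar> > a}) \<le> p (2 * a)"
      unfolding p_def using that by (intro finite_measure_mono) auto
    moreover have "prob ((\<lambda>x. (x + 2) / 4) -` {x. \<bar>x\<bar> > a}) \<le> p (2 * a)"
      unfolding p_def using that by (intro finite_measure_mono) auto
    ultimately show ?thesis
      using self_similar[of "{x. \<bar>x\<bar> > a}"] by (simp add: p_def)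
  qed
  have le_pow: "p 1 \<le> p (2 ^ n)" for n
    by (induction n) (use le[of "2 ^ _"] in \<open>auto intro: order_trans\<close>)
  have "(\<lambda>n. p (2 ^ n)) \<longlonglongrightarrow> prob (\<Inter>n. {x. \<bar>x\<bar> > 2 ^ n})"
    unfolding p_def
    by (rule finite_Lim_measure_decseq)
       (auto simp: decseq_def intro: order.strict_trans1[OF power_increasing])
  moreover have "(\<Inter>n. {x::real. \<bar>x\<bar> > 2 ^ n}) = {}"
  proof -
    have "\<exists>n. \<not> \<bar>x\<bar> > 2 ^ n" for x :: real
      using real_arch_pow[of 2 "\<bar>x\<bar>"] by (metis less_asym one_less_numeral_iff semiring_norm(76))
    then show ?thesis by blast
  qed
  ultimately have "(\<lambda>n. p (2 ^ n)) \<longlonglongrightarrow> 0" by simp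
  then have "p 1 \<le> 0"
    by (rule LIMSEQ_le_const) (use le_pow in auto)
  then have "p 1 = 0" by (simp add: p_def measure_le_0_iff)
  then have "AE x in M. x \<notin> {x. \<bar>x\<bar> > 1}"
    unfolding p_def by (subst (asm) prob_eq_0) auto
  then show ?thesis by (simp add: not_less)
qed

lemma integral_self_similar:
  fixes f :: "real \<Rightarrow> complex"
  assumes "f \<in> borel_measurable borel" and bound: "\<And>x. norm (f x) \<le> B"
  shows "(\<integral>x. f x \<partial>M) = ((\<integral>x. f (x / 4) \<partial>M) + (\<integral>x. f ((x + 2) / 4) \<partial>M)) / 2"
proof -
  \<comment> \<open>Measurability and boundedness are part of the induction predicate so that all
    integrals involved exist and are linear.\<close>
  define P where "P g \<longleftrightarrow> g \<in> borel_measurable borel \<and> (\<exists>B. \<forall>x. norm (g x) \<le> B) \<and>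
    (\<integral>x. g x \<partial>M) = ((\<integral>x. g (x / 4) \<partial>M) + (\<integral>x. g ((x + 2) / 4) \<partial>M)) / 2"
    for g :: "real \<Rightarrow> complex"
  have int: "integrable M g \<and> integrable M (\<lambda>x. g (x / 4)) \<and> integrable M (\<lambda>x. g ((x + 2) / 4))"
    if "P g" for g
  proof -
    obtain B where B: "\<And>x. norm (g x) \<le> B" and [measurable]: "g \<in> borel_measurable borel"
      using \<open>P g\<close> P_def by blast
    then show ?thesis by (intro conjI integrable_bounded[of _ B]) auto
  qed
  have "P f"
  proof (rule borel_complex_induct)
    fix A :: "real set" assume A [measurable]: "A \<in> sets borel"
    have eq: "(indicator A (x / 4) :: complex) = indicator ((\<lambda>x. x / 4) -` A) x"
      "(indicator A ((x + 2) / 4) :: complex) = indicator ((\<lambda>x. (x + 2) / 4) -` A) x" for x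
      by (simp_all add: indicator_def)
    have int: "(\<integral>x. indicator B x \<partial>M) = complex_of_real (prob B)" if "B \<in> sets borel" for B
    proof -
      have "(\<integral>x. indicator B x \<partial>M) = (\<integral>x. complex_of_real (indicator B x) \<partial>M)"
        by (intro Bochner_Integration.integral_cong) (auto simp: indicator_def)
      then show ?thesis using that by (simp only: integral_complex_of_real) simp
    qed
    have [measurable]: "(\<lambda>x. x / 4) -` A \<in> sets borel" "(\<lambda>x. (x + 2) / 4) -` A \<in> sets borel"
      using measurable_sets[of "\<lambda>x. x / 4" borel borel A]
        measurable_sets[of "\<lambda>x. (x + 2) / 4" borel borel A] by simp_all
    show "P (\<lambda>x. indicator A x)"
      unfolding P_def eq(2) unfolding eq(1)
    proof (intro conjI exI[of _ 1] allI)
      show "(\<integral>x. indicator A x \<partial>M) = ((\<integral>x. indicator ((\<lambda>x. x / 4) -` A) x \<partial>M) +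
          (\<integral>x. indicator ((\<lambda>x. (x + 2) / 4) -` A) x \<partial>M)) / (2 :: complex)"
        using self_similar[OF A, THEN arg_cong[of _ _ complex_of_real]] by (simp add: int)
    qed (simp_all add: indicator_def)
  next
    fix c g assume "P g"
    then show "P (\<lambda>x. c * g x)"
      unfolding P_def using int[OF \<open>P g\<close>]
      by (auto simp: norm_mult intro!: exI[of _ "norm c * _"] mult_left_mono)
         (metis distrib_left mult.assoc)
  next
    fix g h assume "P g" "P h"
    then show "P (\<lambda>x. g x + h x)"
      unfolding P_def using int[OF \<open>P g\<close>] int[OF \<open>P h\<close>]
      by (auto simp: add_divide_distrib intro!: exI[of _ "_ + _"] norm_triangle_mono)
  next
    fix s assume s: "\<And>i. P (s i)" "\<And>x. (\<lambda>i. s i x) \<longlonglongrightarrow> f x" "\<And>i x. norm (s i x) \<le> 2 * norm (f x)"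
    have [measurable]: "f \<in> borel_measurable borel" "s i \<in> borel_measurable borel" for i
      using s(1) P_def assms by auto
    have bd: "norm (s i x) \<le> 2 * B" for i x
      using s(3)[of i x] bound[of x] by linarith
    have lim: "(\<lambda>i. \<integral>x. s i (g x) \<partial>M) \<longlonglongrightarrow> (\<integral>x. f (g x) \<partial>M)"
      if [measurable]: "g \<in> borel_measurable borel" for g
      by (rule integral_dominated_convergence[where w="\<lambda>_. 2 * B"]) (use s(2) bd in auto)
    have eq: "(\<integral>x. s i x \<partial>M) = ((\<integral>x. s i (x / 4) \<partial>M) + (\<integral>x. s i ((x + 2) / 4) \<partial>M)) / 2" for i
      using s(1) P_def by blast
    have "(\<lambda>i. \<integral>x. s i x \<partial>M) \<longlonglongrightarrow> ((\<integral>x. f (x / 4) \<partial>M) + (\<integral>x. f ((x + 2) / 4) \<partial>M)) / 2"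
      unfolding eq by (intro tendsto_intros lim) auto
    then show "P f"
      unfolding P_def using LIMSEQ_unique[OF lim[of "\<lambda>x. x"]] bound by auto
  qed (use assms in auto)
  then show ?thesis by (simp add: P_def)
qed

lemma fourier_times_4: "fourier (4 * s) = (1 + cis (4 * pi * s)) / 2 * fourier s"
proof -
  have eq: "wave (4 * s) (x / 4) = wave s x"
    "wave (4 * s) ((x + 2) / 4) = cis (4 * pi * s) * wave s x" for x
    by (simp_all add: wave_def cis_mult algebra_simps add_divide_distrib)
  have "fourier (4 * s) = ((\<integral>x. wave s x \<partial>M) + (\<integral>x. cis (4 * pi * s) * wave s x \<partial>M)) / 2"
    unfolding fourier_def
    by (subst integral_self_similar[of _ 1]) (simp_all add: eq(2), simp add: eq(1))
  then show ?thesis by (simp add: fourier_def field_simps)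
qed

lemma norm_fourier_times_4:
  "(norm (fourier (4 * s)))\<^sup>2 = (1 + cos (4 * pi * s)) / 2 * (norm (fourier s))\<^sup>2"
proof -
  have "(norm (1 + cis \<theta>))\<^sup>2 = 2 * (1 + cos \<theta>)" for \<theta>
    using sin_cos_squared_add[of \<theta>] unfolding cmod_power2 by (simp add: power2_eq_square algebra_simps)
  then show ?thesis
    by (simp add: fourier_times_4 norm_mult norm_divide power_mult_distrib power_divide)
qed

end

section \<open>The transfer operator\<close>

text \<open>The recursion prepends the lowest base-4 digit, matching the scaling of
  \<open>fourier\<close> by 4. The digit 0 makes the stages increasing.\<close>

primrec digit_sums :: "nat \<Rightarrow> nat \<Rightarrow> nat set" where
  "digit_sums m 0 = {0}"
| "digit_sums m (Suc n) = (\<lambda>k. 4 * k) ` digit_sums m n \<union> (\<lambda>k. m + 4 * k) ` digit_sums m n"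

lemma finite_digit_sums [simp]: "finite (digit_sums m n)"
  by (induction n) auto

lemma digit_sums_Suc_mono: "digit_sums m n \<subseteq> digit_sums m (Suc n)"
  by (induction n) auto

lemma digit_sums_mono: "n \<le> n' \<Longrightarrow> digit_sums m n \<subseteq> digit_sums m n'"
  by (rule lift_Suc_mono_le[of "digit_sums m"]) (use digit_sums_Suc_mono in auto)

lemma Gamma_set_eq_digit_sums: "Gamma_set m = (\<Union>n. digit_sums m n)"
proof (intro equalityI subsetI)
  fix x assume "x \<in> Gamma_set m"
  then obtain n l where x: "x = (\<Sum>k=0..n. 4 ^ k * l k)" and l: "\<forall>k\<le>n. l k \<in> {0, m}"
    unfolding Gamma_set_def by blast
  \<comment> \<open>The digits are indexed from 0 to \<open>n\<close>, so there are
    \<open>n + 1\<close> of them and the stage is \<open>Suc n\<close>.\<close>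
  have "(\<Sum>k=0..n. 4 ^ k * l k) \<in> digit_sums m (Suc n)"
    using l
  proof (induction n arbitrary: l)
    case 0
    then show ?case by auto
  next
    case (Suc n)
    have "(\<Sum>k=0..n. 4 ^ k * l (Suc k)) \<in> digit_sums m (Suc n)"
      by (rule Suc.IH) (use Suc.prems in auto)
    moreover have "(\<Sum>k=0..Suc n. 4 ^ k * l k) = l 0 + 4 * (\<Sum>k=0..n. 4 ^ k * l (Suc k))"
      by (subst sum.atLeast0_atMost_Suc_shift) (simp add: sum_distrib_left mult.assoc)
    moreover have "l 0 \<in> {0, m}" using Suc.prems by auto
    ultimately show ?case
      by (subst digit_sums.simps) (auto simp del: digit_sums.simps)
  qed
  then show "x \<in> (\<Union>n. digit_sums m n)" using x by blast
next
  have append: "l + 4 * y \<in> Gamma_set m" if "y \<in> Gamma_set m" "l \<in> {0, m}" for y l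
  proof -
    obtain n d where y: "y = (\<Sum>k=0..n. 4 ^ k * d k)" and d: "\<forall>k\<le>n. d k \<in> {0, m}"
      using \<open>y \<in> Gamma_set m\<close> unfolding Gamma_set_def by blast
    have "l + 4 * y = (\<Sum>k=0..Suc n. 4 ^ k * case_nat l d k)"
      by (subst sum.atLeast0_atMost_Suc_shift) (simp add: y sum_distrib_left mult.assoc)
    moreover have "\<forall>k\<le>Suc n. case_nat l d k \<in> {0, m}"
      using d that(2) by (auto split: nat.split)
    ultimately show ?thesis unfolding Gamma_set_def by blast
  qed
  have "digit_sums m n \<subseteq> Gamma_set m" for n
  proof (induction n)
    case 0
    show ?case by (auto simp: Gamma_set_def intro!: exI[of _ 0] exI[of _ "\<lambda>_. 0"])
  next
    case (Suc n)
    then show ?case using append[of _ 0] append[of _ m] by auto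
  qed
  then show "x \<in> Gamma_set m" if "x \<in> (\<Union>n. digit_sums m n)" for x
    using that by blast
qed

lemma cos_pi_add_odd:
  assumes "odd m"
  shows "cos (x + pi * real m) = - cos x"
  using assms by (simp add: cos_add cos_npi mult.commute[of pi])

lemma half_cos_weights:
  fixes x :: real
  shows "0 \<le> (1 + cos x) / 2" "0 \<le> (1 - cos x) / 2" "(1 + cos x) / 2 + (1 - cos x) / 2 = 1"
proof -
  have "0 \<le> (1 + c) / 2 \<and> 0 \<le> (1 - c) / 2" if "-1 \<le> c" "c \<le> 1" for c :: real
    using that by simp
  from this[OF cos_ge_minus_one cos_le_one]
  show "0 \<le> (1 + cos x) / 2" "0 \<le> (1 - cos x) / 2" by blast+
  show "(1 + cos x) / 2 + (1 - cos x) / 2 = 1" by (simp add: field_simps)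
qed

context cantor4
begin

text \<open>Induction on the number of digits. Equal lowest digits leave 4 times a difference from
  the previous stage, and \<open>fourier_times_4\<close> passes the zero on. Different lowest digits
  give an odd difference, where the scaling factor itself vanishes.\<close>

lemma fourier_diff_digit_sums:
  assumes "odd m" "j \<in> digit_sums m n" "k \<in> digit_sums m n" "j \<noteq> k"
  shows "fourier (real j - real k) = 0"
  using assms(2-4)
proof (induction n arbitrary: j k)
  case 0
  then show ?case by simp
next
  case (Suc n)
  have aux: "fourier (real (m + 4 * x) - real (4 * y)) = 0" for x y
  proof -
    \<comment> \<open>The cosine in \<open>norm_fourier_times_4\<close> is taken at pi times an odd
      integer, hence equals -1.\<close>
    have "norm (fourier (4 * (m / 4 + real x - real y))) ^ 2 = 0"
      using cos_pi_add_odd[OF assms(1), of "2 * pi * of_int (2 * (int x - int y))"]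
        cos_int_2pin[of "2 * (int x - int y)"]
      unfolding norm_fourier_times_4 by (simp add: algebra_simps)
    then show ?thesis by (simp add: algebra_simps)
  qed
  have aux': "fourier (real (4 * y) - real (m + 4 * x)) = 0" for x y
    using aux[of x y] norm_fourier_minus[of "real (m + 4 * x) - real (4 * y)"] by simp
  have same: "fourier (4 * real x - 4 * real y) = 0" if "x \<in> digit_sums m n" "y \<in> digit_sums m n" "x \<noteq> y" for x y
    using Suc.IH[OF that] fourier_times_4[of "real x - real y"] by (simp add: right_diff_distrib)
  show ?case
    using Suc.prems aux aux' same by (auto simp: right_diff_distrib)
qed

lemma fourier_diff_Gamma:
  assumes "odd m" "j \<in> Gamma_set m" "k \<in> Gamma_set m"
  shows "fourier (real j - real k) = (if j = k then 1 else 0)"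
proof (cases "j = k")
  case False
  obtain a b where "j \<in> digit_sums m a" "k \<in> digit_sums m b"
    using assms by (auto simp: Gamma_set_eq_digit_sums)
  then have "j \<in> digit_sums m (max a b)" "k \<in> digit_sums m (max a b)"
    using digit_sums_mono[of a "max a b" m] digit_sums_mono[of b "max a b" m] by auto
  then show ?thesis using fourier_diff_digit_sums[OF assms(1)] False by simp
qed simp

section \<open>Partial sums, their limit, and the minimisers of the limit\<close>

definition frame_sum :: "nat \<Rightarrow> nat \<Rightarrow> real \<Rightarrow> real" where
  "frame_sum m n t = (\<Sum>k\<in>digit_sums m n. (norm (fourier (t + real k)))\<^sup>2)"

lemma frame_sum_0: "frame_sum m 0 t = (norm (fourier t))\<^sup>2"
  by (simp add: frame_sum_def)

lemma frame_sum_nonneg: "0 \<le> frame_sum m n t"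
  by (simp add: frame_sum_def sum_nonneg)

lemma continuous_on_frame_sum: "continuous_on A (frame_sum m n)"
  unfolding frame_sum_def by (intro continuous_intros)

text \<open>The sum is split by the lowest digit. In each half the scaling law produces a weight
  that is the same for all \<open>k\<close>, because 4 * pi * k is a period of the cosine; the shift
  by the odd \<open>m\<close> flips the sign of the cosine.\<close>

lemma frame_sum_Suc:
  assumes "odd m"
  shows "frame_sum m (Suc n) t = (1 + cos (pi * t)) / 2 * frame_sum m n (t / 4) +
    (1 - cos (pi * t)) / 2 * frame_sum m n ((t + real m) / 4)"
proof -
  have shift: "(norm (fourier (s + 4 * real k)))\<^sup>2 =
      (1 + cos (pi * s)) / 2 * (norm (fourier (s / 4 + real k)))\<^sup>2" for s k
    using norm_fourier_times_4[of "s / 4 + real k"] cos_int_2pin[of "2 * int k"]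
      sin_int_2pin[of "2 * int k"]
    by (simp add: ring_distribs cos_add mult_ac)
  have "(\<lambda>k. 4 * k) ` digit_sums m n \<inter> (\<lambda>k. m + 4 * k) ` digit_sums m n = {}"
  proof -
    have "4 * x \<noteq> m + 4 * y" for x y
      using \<open>odd m\<close> by (metis even_add even_mult_iff even_numeral)
    then show ?thesis by blast
  qed
  then have "frame_sum m (Suc n) t =
      (\<Sum>k\<in>digit_sums m n. (norm (fourier (t + 4 * real k)))\<^sup>2) +
      (\<Sum>k\<in>digit_sums m n. (norm (fourier ((t + real m) + 4 * real k)))\<^sup>2)"
    unfolding frame_sum_def digit_sums.simps
    by (subst sum.union_disjoint) (auto simp: sum.reindex inj_on_def add.assoc)
  moreover have "cos (pi * (t + real m)) = - cos (pi * t)"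
    using cos_pi_add_odd[OF assms, of "pi * t"] by (simp add: ring_distribs)
  ultimately show ?thesis
    unfolding shift by (simp add: frame_sum_def sum_distrib_left)
qed

text \<open>This is Bessel's inequality, obtained here because each stage is a convex combination of
  values of the previous one.\<close>

lemma frame_sum_le_1:
  assumes "odd m"
  shows "frame_sum m n t \<le> 1"
proof (induction n arbitrary: t)
  case 0
  show ?case by (simp add: frame_sum_0 norm_fourier_le_1 power_le_one)
next
  case (Suc n)
  show ?case
    unfolding frame_sum_Suc[OF assms]
    by (rule convex_bound_le[OF Suc Suc]) (rule half_cos_weights)+
qed

lemma incseq_frame_sum: "incseq (\<lambda>n. frame_sum m n t)"
  unfolding frame_sum_def
  by (intro incseq_SucI sum_mono2 digit_sums_Suc_mono) auto

definition frame_limit :: "nat \<Rightarrow> real \<Rightarrow> real" where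
  "frame_limit m t = (SUP n. frame_sum m n t)"

lemma bdd_above_frame_sum:
  assumes "odd m"
  shows "bdd_above (range (\<lambda>n. frame_sum m n t))"
  using frame_sum_le_1[OF assms] by (auto intro!: bdd_aboveI)

lemma frame_sum_tendsto:
  assumes "odd m"
  shows "(\<lambda>n. frame_sum m n t) \<longlonglongrightarrow> frame_limit m t"
  unfolding frame_limit_def
  by (rule LIMSEQ_incseq_SUP[OF bdd_above_frame_sum[OF assms] incseq_frame_sum])

lemma frame_limit_le_iff:
  assumes "odd m"
  shows "frame_limit m t \<le> d \<longleftrightarrow> (\<forall>n. frame_sum m n t \<le> d)"
  unfolding frame_limit_def
  by (subst cSUP_le_iff) (auto simp: bdd_above_frame_sum[OF assms])

lemma frame_limit_nonneg: "odd m \<Longrightarrow> 0 \<le> frame_limit m t"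
  by (rule LIMSEQ_le_const[OF frame_sum_tendsto]) (auto simp: frame_sum_nonneg)

lemma frame_limit_eq:
  assumes "odd m"
  shows "frame_limit m t = (1 + cos (pi * t)) / 2 * frame_limit m (t / 4) +
    (1 - cos (pi * t)) / 2 * frame_limit m ((t + real m) / 4)"
proof (rule LIMSEQ_unique)
  show "(\<lambda>n. frame_sum m (Suc n) t) \<longlonglongrightarrow> frame_limit m t"
    using LIMSEQ_Suc[OF frame_sum_tendsto[OF assms]] .
  show "(\<lambda>n. frame_sum m (Suc n) t) \<longlonglongrightarrow> (1 + cos (pi * t)) / 2 * frame_limit m (t / 4) +
    (1 - cos (pi * t)) / 2 * frame_limit m ((t + real m) / 4)"
    unfolding frame_sum_Suc[OF assms] by (intro tendsto_intros frame_sum_tendsto[OF assms])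
qed

text \<open>As a supremum of continuous functions the limit is lower semicontinuous: its sublevel
  sets are intersections of closed ones.\<close>

lemma compact_frame_limit_sublevel:
  assumes "odd m"
  shows "compact {t \<in> {-K..K}. frame_limit m t \<le> d}"
proof -
  have "{t \<in> {-K..K}. frame_limit m t \<le> d} = {-K..K} \<inter> (\<Inter>n. {t. frame_sum m n t \<le> d})"
    by (auto simp: frame_limit_le_iff[OF assms])
  moreover have "closed {t. frame_sum m n t \<le> d}" for n
    by (intro closed_Collect_le continuous_intros continuous_on_frame_sum)
  ultimately show ?thesis by (auto intro!: compact_Int_closed)
qed

lemma integer_orbit_if_frame_limit_less_1:
  assumes "odd m" "frame_limit m t0 < 1"
  obtains Z :: "int set" and K :: int where "Z \<noteq> {}" "0 \<notin> Z" "\<And>k. k \<in> Z \<Longrightarrow> \<bar>k\<bar> \<le> K"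
    "\<And>k. k \<in> Z \<Longrightarrow> \<exists>k'\<in>Z. 4 * k' = k \<or> 4 * k' = k + int m"
proof -
  let ?h = "frame_limit m"
  \<comment> \<open>The interval must contain \<open>t0\<close>, so that the infimum is below 1, and
    \<open>K\<close> at least \<open>m\<close> makes it invariant under both branches.\<close>
  define K where "K = max \<bar>t0\<bar> (real m)"
  define c where "c = (INF t\<in>{-K..K}. ?h t)"
  define Z where "Z = {t \<in> {-K..K}. ?h t \<le> c}"
  have "bdd_below (?h ` {-K..K})"
    using frame_limit_nonneg[OF assms(1)] by (auto intro!: bdd_belowI)
  then have c_le: "c \<le> ?h t" if "t \<in> {-K..K}" for t
    unfolding c_def using that by (rule cINF_lower)
  have t0: "t0 \<in> {-K..K}" unfolding K_def by auto
  have "c < 1" using c_le[OF t0] assms(2) by simp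
  have "closed Z"
    unfolding Z_def by (rule compact_imp_closed[OF compact_frame_limit_sublevel[OF assms(1)]])
  \<comment> \<open>Nested nonempty compact sublevel sets have a common point, so the infimum is
    attained.\<close>
  define F where "F n = {t \<in> {-K..K}. ?h t \<le> c + 1 / real (Suc n)}" for n
  have "(\<Inter>n. F n) \<noteq> {}"
  proof (rule compact_nest)
    show "compact (F n)" for n unfolding F_def by (rule compact_frame_limit_sublevel[OF assms(1)])
    show "F n \<noteq> {}" for n
    proof -
      have "\<exists>t\<in>{-K..K}. ?h t < c + 1 / real (Suc n)"
        unfolding c_def by (rule cInf_lessD[of "?h ` _", simplified]) (use t0 in auto)
      then show ?thesis unfolding F_def by (auto intro: less_imp_le)
    qed
    show "F n' \<subseteq> F n" if "n \<le> n'" for n n'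
    proof -
      have "1 / real (Suc n') \<le> 1 / real (Suc n)" using that by (simp add: frac_le)
      then show ?thesis unfolding F_def by force
    qed
  qed
  then obtain z where z: "\<And>n. z \<in> F n" by blast
  have "?h z \<le> c"
  proof (rule field_le_epsilon)
    fix e :: real assume "0 < e"
    then obtain n where "1 / real (Suc n) < e" using nat_approx_posE by blast
    then show "?h z \<le> c + e" using z[of n] by (simp add: F_def)
  qed
  then have "z \<in> Z" using z[of 0] by (simp add: F_def Z_def)
  have maps: "t / 4 \<in> {-K..K}" "(t + real m) / 4 \<in> {-K..K}" if "t \<in> {-K..K}" for t
  proof -
    have "real m \<le> K" by (simp add: K_def)
    then show "t / 4 \<in> {-K..K}" "(t + real m) / 4 \<in> {-K..K}" using that by auto
  qed
  have Z_step: "(cos (pi * t) \<noteq> -1 \<longrightarrow> t / 4 \<in> Z) \<and> (cos (pi * t) \<noteq> 1 \<longrightarrow> (t + real m) / 4 \<in> Z)"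
    if "t \<in> Z" for t
  proof -
    define a b where "a = (1 + cos (pi * t)) / 2" and "b = (1 - cos (pi * t)) / 2"
    have ab: "0 \<le> a" "0 \<le> b" "a + b = 1" 
      unfolding a_def b_def by (rule half_cos_weights)+
    have t: "t \<in> {-K..K}" "?h t \<le> c" using that by (auto simp: Z_def)
    \<comment> \<open>The excess of \<open>?h t\<close> over \<open>c\<close> is a weighted sum of
      two nonnegative excesses. At a minimiser both terms vanish, so every branch of positive weight
      leads to a minimiser.\<close>
    have "a * (?h (t / 4) - c) + b * (?h ((t + real m) / 4) - c) =
        a * ?h (t / 4) + b * ?h ((t + real m) / 4) - (a + b) * c"
      by (simp add: algebra_simps)
    also have "\<dots> = ?h t - c"
      unfolding frame_limit_eq[OF assms(1), of t] ab(3) unfolding a_def b_def by simp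
    finally have "a * (?h (t / 4) - c) + b * (?h ((t + real m) / 4) - c) = ?h t - c" .
    moreover have "0 \<le> a * (?h (t / 4) - c)" "0 \<le> b * (?h ((t + real m) / 4) - c)"
      using ab c_le maps[OF t(1)] by auto
    ultimately have "a * (?h (t / 4) - c) \<le> 0" "b * (?h ((t + real m) / 4) - c) \<le> 0"
      using t(2) by linarith+
    then have "a \<noteq> 0 \<longrightarrow> ?h (t / 4) \<le> c" "b \<noteq> 0 \<longrightarrow> ?h ((t + real m) / 4) \<le> c"
      using ab by (auto simp: mult_le_0_iff)
    then show ?thesis
      using maps[OF t(1)] by (auto simp: Z_def a_def b_def)
  qed
  have "0 \<notin> Z"
  proof -
    have "frame_sum m 0 0 = 1" by (simp add: frame_sum_0)
    then have "\<not> ?h 0 \<le> c" using \<open>c < 1\<close> frame_limit_le_iff[OF assms(1)] by (metis not_le)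
    then show ?thesis by (simp add: Z_def)
  qed
  have Z_Ints: "t \<in> \<int>" if "t \<in> Z" for t
  proof (rule ccontr)
    assume "t \<notin> \<int>"
    have not_Ints: "t / 4 ^ n \<notin> \<int>" for n
    proof
      assume "t / 4 ^ n \<in> \<int>"
      then have "t / 4 ^ n * 4 ^ n \<in> \<int>" by (intro Ints_mult) auto
      then show False using \<open>t \<notin> \<int>\<close> by simp
    qed
    have in_Z: "t / 4 ^ n \<in> Z" for n
    proof (induction n)
      case (Suc n)
      have "cos (pi * (t / 4 ^ n)) \<noteq> -1"
      proof
        assume "cos (pi * (t / 4 ^ n)) = -1"
        then have "sin (pi * (t / 4 ^ n)) = 0"
          using sin_cos_squared_add[of "pi * (t / 4 ^ n)"] by simp
        then obtain i :: int where "pi * (t / 4 ^ n) = of_int i * pi"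
          using sin_zero_iff_int2 by blast
        then have "t / 4 ^ n = of_int i"
          by (metis mult.commute mult_cancel_right pi_neq_zero)
        then show False using not_Ints[of n] by (metis Ints_of_int)
      qed
      then have "t / 4 ^ n / 4 \<in> Z" using Z_step[OF Suc] by blast
      then show ?case by (simp add: mult.commute)
    qed (use that in simp)
    have "(\<lambda>n. t / 4 ^ n) \<longlonglongrightarrow> 0"
      by (rule LIMSEQ_divide_realpow_zero) simp
    from closed_sequentially[OF \<open>closed Z\<close> in_Z this]
    show False using \<open>0 \<notin> Z\<close> by contradiction
  qed
  show ?thesis
  proof (rule that)
    let ?Z = "{k. of_int k \<in> Z}"
    obtain k where "z = of_int k" using Z_Ints[OF \<open>z \<in> Z\<close>] by (rule Ints_cases)
    then show "?Z \<noteq> {}" using \<open>z \<in> Z\<close> by blast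
    show "0 \<notin> ?Z" using \<open>0 \<notin> Z\<close> by simp
    show "\<bar>k\<bar> \<le> \<lceil>K\<rceil>" if "k \<in> ?Z" for k
    proof -
      have "\<bar>real_of_int k\<bar> \<le> K" using that by (simp add: Z_def abs_le_iff)
      then show ?thesis by (metis ceiling_mono ceiling_of_int of_int_abs)
    qed
    show "\<exists>k'\<in>?Z. 4 * k' = k \<or> 4 * k' = k + int m" if "k \<in> ?Z" for k
    proof (cases "even k")
      case True
      then have "cos (pi * of_int k) = 1" by (auto elim!: evenE simp: cos_int_2pin mult_ac)
      then have Zk: "of_int k / 4 \<in> Z" using Z_step[of "of_int k"] that by auto
      obtain k' where "of_int k / 4 = (of_int k' :: real)" using Z_Ints[OF Zk] by (rule Ints_cases)
      then have "of_int k = (of_int (4 * k') :: real)" "of_int k' \<in> Z" using Zk by auto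
      then show ?thesis by (metis of_int_eq_iff mem_Collect_eq)
    next
      case False
      then have "cos (pi * of_int k) = -1"
        by (auto elim!: oddE simp: ring_distribs cos_add cos_int_2pin sin_int_2pin mult_ac)
      then have Zk: "(of_int k + real m) / 4 \<in> Z" using Z_step[of "of_int k"] that by auto
      obtain k' where "(of_int k + real m) / 4 = (of_int k' :: real)" using Z_Ints[OF Zk] by (rule Ints_cases)
      then have "of_int (k + int m) = (of_int (4 * k') :: real)" "of_int k' \<in> Z" using Zk by auto
      then show ?thesis by (metis of_int_eq_iff mem_Collect_eq)
    qed
  qed
qed

end

section \<open>Density of exponentials\<close>

definition exp_span :: "nat set \<Rightarrow> (real \<Rightarrow> complex) set" where
  "exp_span I = {(\<lambda>x. \<Sum>j\<in>J. c j * exponential j x) | J c. finite J \<and> J \<subseteq> I}"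

lemma exp_span_add:
  assumes "f \<in> exp_span I" "g \<in> exp_span I"
  shows "(\<lambda>x. f x + g x) \<in> exp_span I"
proof -
  obtain J c where f: "f = (\<lambda>x. \<Sum>j\<in>J. c j * exponential j x)" "finite J" "J \<subseteq> I"
    using assms(1) unfolding exp_span_def by blast
  obtain J' c' where g: "g = (\<lambda>x. \<Sum>j\<in>J'. c' j * exponential j x)" "finite J'" "J' \<subseteq> I"
    using assms(2) unfolding exp_span_def by blast
  \<comment> \<open>The index sets may overlap, so both coefficient families are extended by 0 to
    the union and added.\<close>
  define d where "d j = (if j \<in> J then c j else 0) + (if j \<in> J' then c' j else 0)" for j
  have "f x = (\<Sum>j\<in>J \<union> J'. (if j \<in> J then c j else 0) * exponential j x)"
    "g x = (\<Sum>j\<in>J \<union> J'. (if j \<in> J' then c' j else 0) * exponential j x)" for x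
    unfolding f(1) g(1) by (rule sum.mono_neutral_cong_left; use f g in auto)+
  then have "(\<lambda>x. f x + g x) = (\<lambda>x. \<Sum>j\<in>J \<union> J'. d j * exponential j x)"
    by (simp add: d_def distrib_right sum.distrib)
  then show ?thesis
    unfolding exp_span_def using f g by (auto intro!: exI[of _ "J \<union> J'"] exI[of _ d])
qed

lemma exp_span_scale:
  assumes "f \<in> exp_span I"
  shows "(\<lambda>x. a * f x) \<in> exp_span I"
proof -
  obtain J c where f: "f = (\<lambda>x. \<Sum>j\<in>J. c j * exponential j x)" "finite J" "J \<subseteq> I"
    using assms unfolding exp_span_def by blast
  then have "(\<lambda>x. a * f x) = (\<lambda>x. \<Sum>j\<in>J. (a * c j) * exponential j x)"
    by (simp add: sum_distrib_left mult.assoc)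
  then show ?thesis
    unfolding exp_span_def using f by (auto intro!: exI[of _ J] exI[of _ "\<lambda>j. a * c j"])
qed

text \<open>It plays the part of the triangle inequality for squared norms; its factor 2 explains
  the bounds \<open>\<epsilon> / 4\<close> in the density arguments.\<close>

lemma norm_add_squared_le:
  fixes a b :: "'a::real_normed_vector"
  shows "(norm (a + b))\<^sup>2 \<le> 2 * (norm a)\<^sup>2 + 2 * (norm b)\<^sup>2"
proof -
  have "(norm (a + b))\<^sup>2 \<le> (norm a + norm b)\<^sup>2"
    by (intro power_mono norm_triangle_ineq) simp
  also have "\<dots> \<le> 2 * (norm a)\<^sup>2 + 2 * (norm b)\<^sup>2"
    using zero_le_power2[of "norm a - norm b"] by (simp add: power2_eq_square algebra_simps)
  finally show ?thesis .
qed

text \<open>Trigonometric polynomials with arbitrary real frequencies. Integral frequencies alone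
  cannot distinguish \<open>x\<close> from \<open>x + 1\<close>, hence do not separate the points of
  [-1, 1].\<close>

inductive_set wave_polynomials :: "(real \<Rightarrow> complex) set" where
  wave: "wave s \<in> wave_polynomials"
| scale: "f \<in> wave_polynomials \<Longrightarrow> (\<lambda>x. c * f x) \<in> wave_polynomials"
| add: "f \<in> wave_polynomials \<Longrightarrow> g \<in> wave_polynomials \<Longrightarrow> (\<lambda>x. f x + g x) \<in> wave_polynomials"

lemma wave_polynomials_const: "(\<lambda>x. c) \<in> wave_polynomials"
  using wave_polynomials.scale[OF wave_polynomials.wave[of 0], of c] by (simp add: wave_def)

lemma wave_polynomials_mult:
  assumes "f \<in> wave_polynomials" "g \<in> wave_polynomials"
  shows "(\<lambda>x. f x * g x) \<in> wave_polynomials"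
proof -
  have wave: "(\<lambda>x. wave s x * g x) \<in> wave_polynomials" for s
    using assms(2)
  proof induction
    case (wave t)
    then show ?case using wave_polynomials.wave[of "s + t"] by (simp add: wave_add[abs_def])
  next
    case (scale f c)
    then show ?case using wave_polynomials.scale[of _ c] by (simp add: mult.left_commute)
  next
    case (add f g)
    then show ?case using wave_polynomials.add by (simp add: distrib_left)
  qed
  show ?thesis using assms(1)
  proof induction
    case (scale f c)
    then show ?case using wave_polynomials.scale[of _ c] by (simp add: mult.assoc)
  next
    case (add f g)
    then show ?case using wave_polynomials.add by (simp add: distrib_right)
  qed (rule wave)
qed

lemma continuous_on_wave_polynomials: "f \<in> wave_polynomials \<Longrightarrow> continuous_on A f"
proof (induction rule: wave_polynomials.induct)
  case (wave s)
  show ?case unfolding wave_def cis_conv_exp by (intro continuous_intros)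
qed (auto intro!: continuous_intros)

text \<open>The frequency 1/4 separates the points of \<open>[-1, 1]\<close>, since there the argument of the
  sine runs through \<open>[-\<pi>/2, \<pi>/2]\<close>.\<close>

lemma wave_polynomials_uniformly_dense:
  fixes g :: "real \<Rightarrow> real"
  assumes "continuous_on {-1..1} g" "0 < e"
  obtains h where "(\<lambda>x. complex_of_real (h x)) \<in> wave_polynomials"
    "\<And>x. x \<in> {-1..1} \<Longrightarrow> \<bar>g x - h x\<bar> < e"
proof -
  let ?P = "\<lambda>h. (\<lambda>x. complex_of_real (h x)) \<in> wave_polynomials"
  have "\<exists>h. ?P h \<and> (\<forall>x\<in>{-1..1}. \<bar>g x - h x\<bar> < e)"
  proof (rule Stone_Weierstrass_HOL)
    show "?P (\<lambda>x. c)" for c by (rule wave_polynomials_const)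
    show "continuous_on {-1..1} f" if "?P f" for f
      using continuous_on_Re[OF continuous_on_wave_polynomials[OF that]] by simp
    show "?P (\<lambda>x. f x + h x)" if "?P f \<and> ?P h" for f h
      using that wave_polynomials.add by fastforce
    show "?P (\<lambda>x. f x * h x)" if "?P f \<and> ?P h" for f h
      using that wave_polynomials_mult by fastforce
    show "\<exists>f. ?P f \<and> f x \<noteq> f y" if xy: "x \<in> {-1..1} \<and> y \<in> {-1..1} \<and> x \<noteq> y" for x y :: real
    proof (intro exI conjI)
      have "(\<lambda>x. (1 / (2 * \<i>)) * wave (1/4) x + (- 1 / (2 * \<i>)) * wave (-1/4) x) \<in> wave_polynomials"
        by (intro wave_polynomials.intros)
      also have "(\<lambda>x. (1 / (2 * \<i>)) * wave (1/4) x + (- 1 / (2 * \<i>)) * wave (-1/4) x) =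
          (\<lambda>x. complex_of_real (sin (pi * x / 2)))"
        by (rule ext) (simp add: wave_def complex_eq_iff Re_divide Im_divide)
      finally show "?P (\<lambda>x. sin (pi * x / 2))" .
      show "sin (pi * x / 2) \<noteq> sin (pi * y / 2)"
      proof
        assume eq: "sin (pi * x / 2) = sin (pi * y / 2)"
        have range: "- (pi / 2) \<le> pi * z / 2" "pi * z / 2 \<le> pi / 2" if "z \<in> {-1..1}" for z
          using mult_left_mono[of "-1" z pi] mult_left_mono[of z 1 pi] that by auto
        have "pi * x / 2 = pi * y / 2"
          by (rule sin_inj_pi[OF range range eq]) (use xy in simp_all)
        then show False using xy by simp
      qed
    qed
  qed (use assms in auto)
  then show ?thesis using that by blast
qed

section \<open>The closed span of exponentials among square-integrable functions\<close>

context real_distribution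
begin

definition sq_integral :: "(real \<Rightarrow> complex) \<Rightarrow> real" where
  "sq_integral f = (\<integral>x. (norm (f x))\<^sup>2 \<partial>M)"

text \<open>Membership in the closure of the span, stated with the squared distance to avoid square
  roots.\<close>

definition approximable :: "nat set \<Rightarrow> (real \<Rightarrow> complex) \<Rightarrow> bool" where
  "approximable I f \<longleftrightarrow> L2_fun M f \<and>
     (\<forall>\<epsilon>>0. \<exists>g\<in>exp_span I. sq_integral (\<lambda>x. f x - g x) < \<epsilon>)"

lemma L2_fun_bounded:
  assumes [measurable]: "f \<in> borel_measurable borel" and "\<And>x. norm (f x) \<le> B"
  shows "L2_fun M f"
proof -
  have "(norm (f x))\<^sup>2 \<le> B\<^sup>2" for x
    using assms(2) by (intro power_mono) auto
  then show ?thesis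
    unfolding L2_fun_def by (auto intro!: integrable_bounded[of _ "B\<^sup>2"])
qed

lemma L2_fun_add:
  assumes "L2_fun M f" "L2_fun M g"
  shows "L2_fun M (\<lambda>x. f x + g x)"
proof -
  have [measurable]: "f \<in> borel_measurable M" "g \<in> borel_measurable M"
    using assms by (auto simp: L2_fun_def)
  have "integrable M (\<lambda>x. 2 * (norm (f x))\<^sup>2 + 2 * (norm (g x))\<^sup>2)"
    using assms by (auto simp: L2_fun_def)
  then have "integrable M (\<lambda>x. (norm (f x + g x))\<^sup>2)"
    by (rule Bochner_Integration.integrable_bound) (auto intro!: norm_add_squared_le)
  then show ?thesis by (simp add: L2_fun_def)
qed

lemma L2_fun_scale: "L2_fun M f \<Longrightarrow> L2_fun M (\<lambda>x. c * f x)"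
  by (auto simp: L2_fun_def norm_mult power_mult_distrib)

lemma L2_fun_diff: "L2_fun M f \<Longrightarrow> L2_fun M g \<Longrightarrow> L2_fun M (\<lambda>x. f x - g x)"
  using L2_fun_add[of f "\<lambda>x. (-1) * g x"] L2_fun_scale[of g "-1"] by simp

lemma L2_fun_wave: "L2_fun M (wave s)"
  by (rule L2_fun_bounded[of _ 1]) auto

lemma L2_fun_exp_span:
  assumes "f \<in> exp_span I"
  shows "L2_fun M f"
proof -
  obtain J c where f: "f = (\<lambda>x. \<Sum>j\<in>J. c j * exponential j x)"
    using assms unfolding exp_span_def by blast
  have "L2_fun M (\<lambda>x. \<Sum>j\<in>J. c j * exponential j x)"
  proof (induction J rule: infinite_finite_induct)
    case (insert j J)
    then show ?case
      using L2_fun_add[OF L2_fun_scale[OF L2_fun_wave]] by (simp add: exponential_eq_wave)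
  qed (auto intro: L2_fun_bounded[of _ 0])
  then show ?thesis by (simp add: f)
qed

lemma sq_integral_add_le:
  assumes "L2_fun M f" "L2_fun M g"
  shows "sq_integral (\<lambda>x. f x + g x) \<le> 2 * sq_integral f + 2 * sq_integral g"
proof -
  have "sq_integral (\<lambda>x. f x + g x) \<le> (\<integral>x. 2 * (norm (f x))\<^sup>2 + 2 * (norm (g x))\<^sup>2 \<partial>M)"
    unfolding sq_integral_def
    by (rule integral_mono) (use assms L2_fun_add[OF assms] norm_add_squared_le in \<open>auto simp: L2_fun_def\<close>)
  also have "\<dots> = 2 * sq_integral f + 2 * sq_integral g"
    using assms by (simp add: L2_fun_def sq_integral_def)
  finally show ?thesis .
qed

lemma approximableD_L2: "approximable I f \<Longrightarrow> L2_fun M f"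
  by (simp add: approximable_def)

lemma approximable_add:
  assumes "approximable I f" "approximable I g"
  shows "approximable I (\<lambda>x. f x + g x)"
  unfolding approximable_def
proof (intro conjI allI impI)
  show "L2_fun M (\<lambda>x. f x + g x)"
    using assms by (intro L2_fun_add approximableD_L2)
  fix \<epsilon> :: real assume "0 < \<epsilon>"
  then have "0 < \<epsilon> / 4" by simp
  then obtain f' g' where f': "f' \<in> exp_span I" "sq_integral (\<lambda>x. f x - f' x) < \<epsilon> / 4"
    and g': "g' \<in> exp_span I" "sq_integral (\<lambda>x. g x - g' x) < \<epsilon> / 4"
    using assms unfolding approximable_def by meson
  have "sq_integral (\<lambda>x. (f x - f' x) + (g x - g' x)) < \<epsilon>"
    using sq_integral_add_le[of "\<lambda>x. f x - f' x" "\<lambda>x. g x - g' x"] f' g'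
      L2_fun_diff[OF approximableD_L2[OF assms(1)] L2_fun_exp_span[OF f'(1)]]
      L2_fun_diff[OF approximableD_L2[OF assms(2)] L2_fun_exp_span[OF g'(1)]] by linarith
  then show "\<exists>h\<in>exp_span I. sq_integral (\<lambda>x. f x + g x - h x) < \<epsilon>"
    using exp_span_add[OF f'(1) g'(1)] by (intro bexI) (auto simp: algebra_simps)
qed

lemma approximable_scale:
  assumes "approximable I f"
  shows "approximable I (\<lambda>x. c * f x)"
  unfolding approximable_def
proof (intro conjI allI impI)
  show "L2_fun M (\<lambda>x. c * f x)"
    using assms by (intro L2_fun_scale approximableD_L2)
  fix \<epsilon> :: real assume "0 < \<epsilon>"
  \<comment> \<open>The added 1 keeps the denominator positive when \<open>c\<close> is 0.\<close>
  then have "0 < \<epsilon> / ((norm c)\<^sup>2 + 1)" by (intro divide_pos_pos) (auto intro: add_nonneg_pos)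
  then obtain g where g: "g \<in> exp_span I" "sq_integral (\<lambda>x. f x - g x) < \<epsilon> / ((norm c)\<^sup>2 + 1)"
    using assms unfolding approximable_def by meson
  have "sq_integral (\<lambda>x. c * f x - c * g x) = (norm c)\<^sup>2 * sq_integral (\<lambda>x. f x - g x)"
    unfolding sq_integral_def
    by (simp add: norm_mult power_mult_distrib flip: right_diff_distrib)
  also have "\<dots> \<le> ((norm c)\<^sup>2 + 1) * sq_integral (\<lambda>x. f x - g x)"
    by (intro mult_right_mono) (auto simp: sq_integral_def)
  also have "\<dots> < \<epsilon>"
    using g(2) by (simp add: pos_less_divide_eq add_nonneg_pos mult.commute)
  finally show "\<exists>h\<in>exp_span I. sq_integral (\<lambda>x. c * f x - h x) < \<epsilon>"
    by (intro bexI[of _ "\<lambda>x. c * g x"] exp_span_scale g)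
qed

lemma approximable_closed:
  assumes "L2_fun M f" "\<And>\<epsilon>. 0 < \<epsilon> \<Longrightarrow> \<exists>g. approximable I g \<and> sq_integral (\<lambda>x. f x - g x) < \<epsilon>"
  shows "approximable I f"
  unfolding approximable_def
proof (intro conjI allI impI)
  fix \<epsilon> :: real assume "0 < \<epsilon>"
  then have "0 < \<epsilon> / 4" by simp
  then obtain g h where g: "approximable I g" "sq_integral (\<lambda>x. f x - g x) < \<epsilon> / 4"
    and h: "h \<in> exp_span I" "sq_integral (\<lambda>x. g x - h x) < \<epsilon> / 4"
    using assms(2) unfolding approximable_def by meson
  have "sq_integral (\<lambda>x. (f x - g x) + (g x - h x)) < \<epsilon>"
    using sq_integral_add_le[of "\<lambda>x. f x - g x" "\<lambda>x. g x - h x"] g h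
      L2_fun_diff[OF assms(1) approximableD_L2[OF g(1)]]
      L2_fun_diff[OF approximableD_L2[OF g(1)] L2_fun_exp_span[OF h(1)]] by linarith
  then show "\<exists>h\<in>exp_span I. sq_integral (\<lambda>x. f x - h x) < \<epsilon>"
    using h(1) by auto
qed (rule assms)

lemma approximable_lim:
  assumes "\<And>i. approximable I (s i)" "\<And>x. (\<lambda>i. s i x) \<longlonglongrightarrow> f x"
    "\<And>i x. norm (s i x) \<le> 2 * norm (f x)" "L2_fun M f"
  shows "approximable I f"
proof (rule approximable_closed)
  have [measurable]: "f \<in> borel_measurable M" "s i \<in> borel_measurable M" for i
    using assms(4) approximableD_L2[OF assms(1)] by (auto simp: L2_fun_def)
  have "(\<lambda>i. sq_integral (\<lambda>x. f x - s i x)) \<longlonglongrightarrow> (\<integral>x. 0 \<partial>M)"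
    unfolding sq_integral_def
  \<comment> \<open>The constant 9 is the square of 3: the difference is bounded by
    \<open>norm (f x)\<close> plus \<open>2 * norm (f x)\<close>.\<close>
  proof (rule integral_dominated_convergence[where w="\<lambda>x. 9 * (norm (f x))\<^sup>2"])
    show "integrable M (\<lambda>x. 9 * (norm (f x))\<^sup>2)" using assms(4) by (simp add: L2_fun_def)
    show "AE x in M. (\<lambda>i. (norm (f x - s i x))\<^sup>2) \<longlonglongrightarrow> 0"
    proof (intro AE_I2)
      fix x
      have "(\<lambda>i. (norm (f x - s i x))\<^sup>2) \<longlonglongrightarrow> (norm (f x - f x))\<^sup>2"
        by (intro tendsto_intros assms(2))
      then show "(\<lambda>i. (norm (f x - s i x))\<^sup>2) \<longlonglongrightarrow> 0" by simp
    qed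
    have "(norm (f x - s i x))\<^sup>2 \<le> (3 * norm (f x))\<^sup>2" for i x
      using norm_triangle_ineq4[of "f x" "s i x"] assms(3)[of i x] by (intro power_mono) auto
    then show "AE x in M. norm ((norm (f x - s i x))\<^sup>2) \<le> 9 * (norm (f x))\<^sup>2" for i
      by (simp add: power_mult_distrib)
  qed auto
  then have lim: "(\<lambda>i. sq_integral (\<lambda>x. f x - s i x)) \<longlonglongrightarrow> 0" by simp
  show "\<exists>g. approximable I g \<and> sq_integral (\<lambda>x. f x - g x) < \<epsilon>" if "0 < \<epsilon>" for \<epsilon>
    using order_tendstoD(2)[OF lim that] assms(1) eventually_happens'[OF sequentially_bot] by blast
qed (rule assms)

lemma approximable_wave_polynomials:
  assumes "\<And>s. approximable I (wave s)" "f \<in> wave_polynomials"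
  shows "approximable I f"
  using assms(2) by induction (auto intro: assms(1) approximable_add approximable_scale)

text \<open>Outer regularity is applied to \<open>A\<close> and to its complement; the closed set is
  the complement of the open superset \<open>V\<close> of \<open>- A\<close>. Since \<open>U\<close>
  and \<open>V\<close> cover the line, the gap has probability
  \<open>prob U + prob V - 1\<close>.\<close>

lemma Borel_set_between_closed_open:
  assumes "A \<in> sets borel" "0 < \<epsilon>"
  obtains K U where "closed K" "open U" "K \<subseteq> A" "A \<subseteq> U" "prob (U - K) < \<epsilon>"
proof -
  have outer: "\<exists>U. open U \<and> B \<subseteq> U \<and> prob U < prob B + \<epsilon> / 2" if "B \<in> sets borel" for B
  proof -
    have "emeasure M B = (INF U\<in>{U. B \<subseteq> U \<and> open U}. emeasure M U)"
      by (rule outer_regular) (use that in auto)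
    moreover have "emeasure M B < emeasure M B + ennreal (\<epsilon> / 2)"
      using \<open>0 < \<epsilon>\<close> by (simp add: emeasure_eq_measure ennreal_less_iff flip: ennreal_plus)
    ultimately have "(INF U\<in>{U. B \<subseteq> U \<and> open U}. emeasure M U) < emeasure M B + ennreal (\<epsilon> / 2)"
      by (simp only:)
    then obtain U where U: "open U" "B \<subseteq> U" "emeasure M U < emeasure M B + ennreal (\<epsilon> / 2)"
      by (auto simp: INF_less_iff)
    then show ?thesis
      using \<open>0 < \<epsilon>\<close> by (auto simp: emeasure_eq_measure ennreal_less_iff simp flip: ennreal_plus)
  qed
  obtain U where U: "open U" "A \<subseteq> U" "prob U < prob A + \<epsilon> / 2" using outer assms(1) by blast
  obtain V where V: "open V" "- A \<subseteq> V" "prob V < prob (- A) + \<epsilon> / 2"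
    using outer[of "- A"] assms(1) by auto
  have "prob (U - (- V)) = prob U + prob V - prob (U \<union> V)"
    using U V by (simp add: measure_Un3 fmeasurable_eq_sets Diff_eq)
  moreover have "U \<union> V = UNIV" using U V by auto
  moreover have "prob (- A) = 1 - prob A"
    using prob_compl[of A] assms(1) by (simp add: Compl_eq_Diff_UNIV)
  ultimately have "prob (U - (- V)) < \<epsilon>"
    using U V prob_space by simp
  then show ?thesis using that[of "- V" U] U V by auto
qed

end

section \<open>From waves to all square-integrable functions, and completeness\<close>

context cantor4
begin

text \<open>Uniform approximation on [-1, 1] is enough, because the measure is carried by that
  interval and the values of \<open>h\<close> elsewhere do not affect the integral.\<close>

lemma approximable_continuous:
  fixes g :: "real \<Rightarrow> real"
  assumes "\<And>s. approximable I (wave s)" "continuous_on UNIV g" "\<And>x. \<bar>g x\<bar> \<le> B"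
  shows "approximable I (\<lambda>x. complex_of_real (g x))"
proof (rule approximable_closed)
  have [measurable]: "g \<in> borel_measurable borel"
    using assms(2) by (rule borel_measurable_continuous_onI)
  show L2: "L2_fun M (\<lambda>x. complex_of_real (g x))"
    by (rule L2_fun_bounded[of _ B]) (use assms(3) in auto)
  fix \<epsilon> :: real assume "0 < \<epsilon>"
  \<comment> \<open>With \<open>e\<close> at most 1 and at most half of \<open>\<epsilon>\<close>,
    its square is below \<open>\<epsilon>\<close>.\<close>
  define e where "e = min 1 (\<epsilon> / 2)"
  have e: "0 < e" "e\<^sup>2 < \<epsilon>"
  proof -
    show "0 < e" using \<open>0 < \<epsilon>\<close> by (simp add: e_def)
    moreover have e_le: "e \<le> 1" "e \<le> \<epsilon> / 2" by (simp_all add: e_def)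
    ultimately have "e * e \<le> e * 1" by (intro mult_left_mono) auto
    then show "e\<^sup>2 < \<epsilon>"
      using \<open>0 < e\<close> e_le(2) unfolding power2_eq_square by linarith
  qed
  have "continuous_on {-1..1} g"
    using assms(2) continuous_on_subset by blast
  then obtain h where h: "(\<lambda>x. complex_of_real (h x)) \<in> wave_polynomials"
      "\<And>x. x \<in> {-1..1} \<Longrightarrow> \<bar>g x - h x\<bar> < e"
    using wave_polynomials_uniformly_dense e(1) by blast
  have approx: "approximable I (\<lambda>x. complex_of_real (h x))"
    by (rule approximable_wave_polynomials[OF assms(1) h(1)])
  have "sq_integral (\<lambda>x. complex_of_real (g x) - complex_of_real (h x)) \<le> (\<integral>x. e\<^sup>2 \<partial>M)"
    unfolding sq_integral_def
  proof (rule integral_mono_AE)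
    show "AE x in M. (norm (complex_of_real (g x) - complex_of_real (h x)))\<^sup>2 \<le> e\<^sup>2"
      using AE_abs_le_1
    proof eventually_elim
      case (elim x)
      have "norm (complex_of_real (g x) - complex_of_real (h x)) = \<bar>g x - h x\<bar>"
        by (simp flip: of_real_diff)
      moreover have "x \<in> {-1..1}" using elim by auto
      ultimately show ?case using h(2)[of x] by (intro power_mono) auto
    qed
  qed (use L2_fun_diff[OF L2 approximableD_L2[OF approx]] in \<open>auto simp: L2_fun_def\<close>)
  then have "sq_integral (\<lambda>x. complex_of_real (g x) - complex_of_real (h x)) < \<epsilon>"
    using e(2) prob_space by simp
  then show "\<exists>f. approximable I f \<and> sq_integral (\<lambda>x. complex_of_real (g x) - f x) < \<epsilon>"
    using approx by blast
qed

text \<open>A Urysohn function between \<open>K\<close> and the complement of \<open>U\<close>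
  agrees with the indicator off \<open>U - K\<close> and differs from it by at most 1 on that small
  set.\<close>

lemma approximable_indicator:
  assumes "\<And>s. approximable I (wave s)" and [measurable]: "A \<in> sets borel"
  shows "approximable I (\<lambda>x. indicator A x)"
proof (rule approximable_closed)
  show L2: "L2_fun M (\<lambda>x. indicator A x)"
    by (rule L2_fun_bounded[of _ 1]) (auto simp: indicator_def)
  fix \<epsilon> :: real assume "0 < \<epsilon>"
  then obtain K U where KU: "closed K" "open U" "K \<subseteq> A" "A \<subseteq> U" "prob (U - K) < \<epsilon>"
    using Borel_set_between_closed_open assms(2) by blast
  have [measurable]: "U - K \<in> sets borel" using KU by auto
  obtain g :: "real \<Rightarrow> real" where g: "continuous_on UNIV g" "\<And>x. g x \<in> closed_segment 1 0"
      "\<And>x. x \<in> K \<Longrightarrow> g x = 1" "\<And>x. x \<in> - U \<Longrightarrow> g x = 0"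
    by (rule Urysohn[of K "- U" 1 "0 :: real"]) (use KU in auto)
  have g01: "0 \<le> g x" "g x \<le> 1" for x
    using g(2)[of x] by (auto simp: closed_segment_eq_real_ivl)
  have approx: "approximable I (\<lambda>x. complex_of_real (g x))"
    by (rule approximable_continuous[OF assms(1) g(1), of 1]) (use g01 in auto)
  have int: "integrable M (indicat_real (U - K))"
    by (rule integrable_bounded[of _ 1]) (auto simp: indicator_def)
  have "sq_integral (\<lambda>x. indicator A x - complex_of_real (g x)) \<le> (\<integral>x. indicator (U - K) x \<partial>M)"
    unfolding sq_integral_def
  proof (rule integral_mono)
    fix x
    have "1 - complex_of_real (g x) = complex_of_real (1 - g x)" by simp
    then have "norm (1 - complex_of_real (g x)) \<le> 1"
      using g01[of x] by (simp only: norm_of_real)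
    moreover have "norm (complex_of_real (g x)) \<le> 1" using g01[of x] by simp
    ultimately show "(norm (indicator A x - complex_of_real (g x)))\<^sup>2 \<le> indicator (U - K) x"
      using KU g(3,4)[of x] by (auto simp: indicator_def power_le_one)
  qed (use int L2_fun_diff[OF L2 approximableD_L2[OF approx]] in \<open>auto simp: L2_fun_def\<close>)
  also have "\<dots> < \<epsilon>" using KU by simp
  finally show "\<exists>f. approximable I f \<and> sq_integral (\<lambda>x. indicator A x - f x) < \<epsilon>"
    using approx by blast
qed

lemma approximable_if_L2_fun:
  assumes "\<And>s. approximable I (wave s)" "L2_fun M f"
  shows "approximable I f"
proof (rule borel_complex_induct[of f])
  show "f \<in> borel_measurable borel" 
    using assms(2) measurable_cong_sets[OF events_eq_borel refl] unfolding L2_fun_def by blast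
  show "approximable I (\<lambda>x. indicator A x)" if "A \<in> sets borel" for A
    by (rule approximable_indicator[OF assms(1) that])
  show "approximable I f" if "\<And>i. approximable I (s i)" "\<And>x. (\<lambda>i. s i x) \<longlonglongrightarrow> f x"
    "\<And>i x. norm (s i x) \<le> 2 * norm (f x)" for s
    by (rule approximable_lim[OF that assms(2)])
qed (rule approximable_scale approximable_add; assumption)+

text \<open>Pythagoras for the orthogonal projection: the coefficients are the inner products of the
  wave with the exponentials. The argument is \<open>- s\<close> because \<open>frame_sum\<close>
  adds the frequencies, and the modulus of \<open>fourier\<close> is even.\<close>

lemma sq_integral_wave_diff_projection:
  assumes "odd m"
  shows "sq_integral (\<lambda>x. wave s x - (\<Sum>j\<in>digit_sums m n. fourier (s - real j) * exponential j x)) =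
    1 - frame_sum m n (- s)"
proof -
  let ?J = "digit_sums m n"
  let ?c = "\<lambda>j. fourier (s - real j)"
  let ?u = "\<lambda>x. wave s x - (\<Sum>j\<in>?J. ?c j * exponential j x)"
  have "complex_of_real ((norm (?u x))\<^sup>2) = wave 0 x - (\<Sum>j\<in>?J. cnj (?c j) * wave (s - real j) x)
      - (\<Sum>j\<in>?J. ?c j * wave (real j - s) x)
      + (\<Sum>j\<in>?J. \<Sum>k\<in>?J. ?c j * cnj (?c k) * wave (real j - real k) x)" for x
  proof -
    have "complex_of_real ((norm (?u x))\<^sup>2) = ?u x * cnj (?u x)"
      by (rule complex_norm_square)
    also have "\<dots> = wave s x * cnj (wave s x) - wave s x * cnj (\<Sum>j\<in>?J. ?c j * exponential j x)
        - (\<Sum>j\<in>?J. ?c j * exponential j x) * cnj (wave s x)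
        + (\<Sum>j\<in>?J. ?c j * exponential j x) * cnj (\<Sum>j\<in>?J. ?c j * exponential j x)"
      by (simp add: algebra_simps)
    also have "wave s x * cnj (wave s x) = wave 0 x"
      using wave_diff[of s s x] by simp
    also have "wave s x * cnj (\<Sum>j\<in>?J. ?c j * exponential j x) = (\<Sum>j\<in>?J. cnj (?c j) * wave (s - real j) x)"
      by (simp add: exponential_eq_wave wave_diff sum_distrib_left mult_ac)
    also have "(\<Sum>j\<in>?J. ?c j * exponential j x) * cnj (wave s x) = (\<Sum>j\<in>?J. ?c j * wave (real j - s) x)"
      by (simp add: exponential_eq_wave wave_diff sum_distrib_left mult_ac)
    also have "(\<Sum>j\<in>?J. ?c j * exponential j x) * cnj (\<Sum>j\<in>?J. ?c j * exponential j x) =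
        (\<Sum>j\<in>?J. \<Sum>k\<in>?J. ?c j * cnj (?c k) * wave (real j - real k) x)"
      unfolding cnj_sum sum_product
      by (intro sum.cong refl) (simp add: exponential_eq_wave wave_diff)
    finally show ?thesis .
  qed
  moreover have "complex_of_real (sq_integral ?u) = (\<integral>x. complex_of_real ((norm (?u x))\<^sup>2) \<partial>M)"
    unfolding sq_integral_def by (rule integral_complex_of_real[symmetric])
  ultimately have "complex_of_real (sq_integral ?u) =
      fourier 0 - (\<Sum>j\<in>?J. cnj (?c j) * ?c j) - (\<Sum>j\<in>?J. ?c j * fourier (real j - s))
      + (\<Sum>j\<in>?J. \<Sum>k\<in>?J. ?c j * cnj (?c k) * fourier (real j - real k))"
    by (simp add: fourier_def)
  also have "(\<Sum>j\<in>?J. \<Sum>k\<in>?J. ?c j * cnj (?c k) * fourier (real j - real k)) =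
      (\<Sum>j\<in>?J. ?c j * cnj (?c j))"
  proof (rule sum.cong)
    fix j assume j: "j \<in> ?J"
    have "(\<Sum>k\<in>?J. ?c j * cnj (?c k) * fourier (real j - real k)) =
        (\<Sum>k\<in>?J. if j = k then ?c j * cnj (?c k) else 0)"
      using fourier_diff_digit_sums[OF assms j] by (intro sum.cong) auto
    then show "(\<Sum>k\<in>?J. ?c j * cnj (?c k) * fourier (real j - real k)) = ?c j * cnj (?c j)"
      using j by simp
  qed simp
  also have "(\<Sum>j\<in>?J. ?c j * fourier (real j - s)) = (\<Sum>j\<in>?J. ?c j * cnj (?c j))"
    by (simp add: cnj_fourier)
  also have "(\<Sum>j\<in>?J. ?c j * cnj (?c j)) = complex_of_real (frame_sum m n (- s))"
    unfolding frame_sum_def of_real_sum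
  proof (intro sum.cong refl)
    fix j
    have "norm (fourier (- s + real j)) = norm (?c j)"
      using norm_fourier_minus[of "s - real j"] by simp
    then show "?c j * cnj (?c j) = complex_of_real ((norm (fourier (- s + real j)))\<^sup>2)"
      by (simp only: complex_norm_square)
  qed
  finally have "complex_of_real (sq_integral ?u) = complex_of_real (1 - frame_sum m n (- s))"
    using \<open>(\<Sum>j\<in>?J. ?c j * cnj (?c j)) = complex_of_real (frame_sum m n (- s))\<close>
    by (simp add: mult.commute)
  then show ?thesis using of_real_eq_iff by blast
qed

lemma complete_number_if_frame_limit_ge_1:
  assumes "odd m" "\<And>t. 1 \<le> frame_limit m t"
  shows "complete_number M m"
proof -
  have "approximable (Gamma_set m) (wave s)" for s
    unfolding approximable_def
  proof (intro conjI allI impI L2_fun_wave)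
    fix \<epsilon> :: real assume "0 < \<epsilon>"
    then have "1 - \<epsilon> < frame_limit m (- s)" using assms(2)[of "- s"] by linarith
    from order_tendstoD(1)[OF frame_sum_tendsto[OF assms(1)] this]
    obtain n where n: "1 - \<epsilon> < frame_sum m n (- s)"
      using eventually_happens'[OF sequentially_bot] by blast
    have "(\<lambda>x. \<Sum>j\<in>digit_sums m n. fourier (s - real j) * exponential j x) \<in> exp_span (Gamma_set m)"
      unfolding exp_span_def Gamma_set_eq_digit_sums by (auto intro!: exI[of _ "digit_sums m n"])
    then show "\<exists>g\<in>exp_span (Gamma_set m). sq_integral (\<lambda>x. wave s x - g x) < \<epsilon>"
      using n sq_integral_wave_diff_projection[OF assms(1)] by (intro bexI) auto
  qed
  note approx = approximable_if_L2_fun[OF this]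
  show ?thesis
    unfolding complete_number_def orthonormal_basis_L2_def
  proof (intro conjI ballI allI impI)
    show "L2_fun M (exponential i)" for i
      by (simp add: exponential_eq_wave L2_fun_wave)
    show "L2_inner M (exponential i) (exponential j) = (if i = j then 1 else 0)"
      if "i \<in> Gamma_set m" "j \<in> Gamma_set m" for i j
      using fourier_diff_Gamma[OF assms(1) that]
      by (simp add: L2_inner_def exponential_eq_wave fourier_def flip: wave_diff)
    fix f and \<epsilon> :: real assume "L2_fun M f" "0 < \<epsilon>"
    \<comment> \<open>\<open>L2_dist\<close> takes a square root, so the squared error is made
      smaller than the square of \<open>\<epsilon>\<close>.\<close>
    then obtain g where g: "g \<in> exp_span (Gamma_set m)" "sq_integral (\<lambda>x. f x - g x) < \<epsilon>\<^sup>2"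
      using approx[of f] unfolding approximable_def by (meson zero_less_power)
    then have "L2_dist M f g < \<epsilon>"
      using real_sqrt_less_mono[OF g(2)] \<open>0 < \<epsilon>\<close> by (simp add: L2_dist_def sq_integral_def)
    then show "\<exists>J c. finite J \<and> J \<subseteq> Gamma_set m \<and>
        L2_dist M f (\<lambda>x. \<Sum>j\<in>J. c j * exponential j x) < \<epsilon>"
      using g(1) unfolding exp_span_def by blast
  qed
qed

end

section \<open>Integer orbits and completeness\<close>

text \<open>Following the orbit for many steps contracts it towards [0, m/3], so a late orbit point
  lies in that interval; the endpoints are excluded by \<open>0 \<notin> Z\<close> and by 3 not
  dividing \<open>m\<close>. Each step divides by 4 modulo \<open>m\<close>, so a suitable late
  point is the residue of \<open>4 ^ j * k0\<close>.\<close>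

lemma orbit_mod_in_third:
  fixes Z :: "int set" and m :: nat and K :: int
  assumes "odd m" "\<not> 3 dvd m" "0 \<notin> Z" and K: "\<And>k. k \<in> Z \<Longrightarrow> \<bar>k\<bar> \<le> K"
    and step: "\<And>k. k \<in> Z \<Longrightarrow> \<exists>k'\<in>Z. 4 * k' = k \<or> 4 * k' = k + int m" and "k0 \<in> Z"
  shows "0 < 4 ^ j * k0 mod int m \<and> 3 * (4 ^ j * k0 mod int m) < int m"
proof -
  \<comment> \<open>After \<open>n\<close> steps, \<open>4 ^ n * k\<close> is \<open>k0\<close> plus
    \<open>m\<close> times a sum of distinct powers of 4 with exponents below \<open>n\<close>, and
    that sum is at most a third of \<open>4 ^ n - 1\<close>. The factor 3 avoids division.\<close>
  have descent: "\<exists>k\<in>Z. - K \<le> 4 ^ n * k \<and> 3 * (4 ^ n * k) \<le> 3 * K + (4 ^ n - 1) * int m \<and>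
      [4 ^ n * k = k0] (mod int m)" for n
  proof (induction n)
    case 0
    then show ?case using K[OF \<open>k0 \<in> Z\<close>] \<open>k0 \<in> Z\<close> by (intro bexI[of _ k0]) auto
  next
    case (Suc n)
    then obtain k where k: "k \<in> Z" "- K \<le> 4 ^ n * k" "3 * (4 ^ n * k) \<le> 3 * K + (4 ^ n - 1) * int m"
      "[4 ^ n * k = k0] (mod int m)" by blast
    obtain k' e where k': "k' \<in> Z" "4 * k' = k + e * int m" "e = 0 \<or> e = 1"
      using step[OF k(1)] by force
    have "4 ^ Suc n * k' = 4 ^ n * (4 * k')" by simp
    then have eq: "4 ^ Suc n * k' = 4 ^ n * k + 4 ^ n * (e * int m)"
      by (simp only: k'(2) distrib_left)
    have e: "0 \<le> 4 ^ n * (e * int m)" "4 ^ n * (e * int m) \<le> 4 ^ n * int m"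
      using k'(3) by auto
    have "[4 ^ Suc n * k' = k0] (mod int m)"
    proof -
      have "[4 ^ n * (e * int m) = 0] (mod int m)" by (simp add: cong_0_iff)
      from cong_add[OF k(4) this] show ?thesis unfolding eq by simp
    qed
    moreover have "- K \<le> 4 ^ Suc n * k'" unfolding eq using k(2) e(1) by linarith
    moreover have "3 * (4 ^ Suc n * k') \<le> 3 * K + (4 ^ Suc n - 1) * int m"
      unfolding eq using k(3) e(2) by (simp add: algebra_simps)
    ultimately show ?case using k'(1) by blast
  qed
  have "coprime (2 ^ 2) m" using \<open>odd m\<close> by (simp only: coprime_power_left_iff coprime_left_2_iff_odd) simp
  then have "coprime 4 m" by simp
  then have euler: "[4 ^ totient m = 1] (mod m)" by (rule euler_theorem)
  define p where "p = totient m"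
  have "0 < p" using \<open>odd m\<close> by (auto simp: p_def odd_pos)
  have p: "[4 ^ p = 1] (mod int m)"
    using euler by (metis p_def cong_int_iff of_nat_1 of_nat_numeral of_nat_power)
  \<comment> \<open>\<open>n + j\<close> is a multiple of the period \<open>p\<close>, so
    \<open>4 ^ n\<close> inverts \<open>4 ^ j\<close> modulo \<open>m\<close>, while
    \<open>n\<close> is large enough for \<open>4 ^ n\<close> to exceed
    \<open>3 * K\<close>.\<close>
  define n where "n = p * (nat (3 * K) + 1 + j) - j"
  have "1 \<le> p" using \<open>0 < p\<close> by simp
  from mult_le_mono1[OF this, of "nat (3 * K) + 1 + j"]
  have "nat (3 * K) + 1 + j \<le> p * (nat (3 * K) + 1 + j)" by (simp only: mult_1)
  then have n: "nat (3 * K) + 1 \<le> n" "n + j = p * (nat (3 * K) + 1 + j)" by (auto simp: n_def)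
  obtain k where k: "k \<in> Z" "- K \<le> 4 ^ n * k" "3 * (4 ^ n * k) \<le> 3 * K + (4 ^ n - 1) * int m"
      "[4 ^ n * k = k0] (mod int m)" using descent by blast
  have "n < 4 ^ n" by (rule power_gt_expt) simp
  then have "int n < 4 ^ n" by (metis of_nat_less_iff of_nat_numeral of_nat_power)
  then have big: "3 * K < 4 ^ n" using n(1) by linarith
  have "0 \<le> K" using K[OF \<open>k0 \<in> Z\<close>] by simp
  have "0 \<le> k"
  proof (rule ccontr)
    assume "\<not> 0 \<le> k"
    then have "4 ^ n * k \<le> 4 ^ n * (-1)" by (intro mult_left_mono) auto
    then show False using k(2) big \<open>0 \<le> K\<close> by linarith
  qed
  then have "0 < k" using k(1) assms(3) by (metis order_le_less)
  have "3 * k \<le> int m"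
  proof (rule ccontr)
    assume "\<not> 3 * k \<le> int m"
    then have "4 ^ n * (int m + 1) \<le> 4 ^ n * (3 * k)" by (intro mult_left_mono) auto
    then have "4 ^ n * int m + 4 ^ n \<le> 3 * (4 ^ n * k)" by (simp add: algebra_simps)
    then show False using k(3) big by (simp add: algebra_simps)
  qed
  moreover have "3 * k \<noteq> int m"
    using assms(2) by (metis dvd_triv_left int_dvd_int_iff of_nat_numeral)
  ultimately have "3 * k < int m" by simp
  have "[4 ^ (n + j) = 1] (mod int m)"
    unfolding n(2) power_mult
    using cong_pow[OF p, of "nat (3 * K) + 1 + j"] by (simp only: power_one)
  then have "[4 ^ (n + j) * k = 1 * k] (mod int m)" by (rule cong_mult) simp
  moreover have "[4 ^ j * (4 ^ n * k) = 4 ^ j * k0] (mod int m)"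
    by (intro cong_mult k(4)) simp
  ultimately have "[4 ^ j * k0 = k] (mod int m)"
    by (simp add: power_add mult_ac) (metis cong_sym cong_trans)
  then have "4 ^ j * k0 mod int m = k"
    using \<open>0 < k\<close> \<open>3 * k < int m\<close> by (simp add: cong_def)
  then show ?thesis using \<open>0 < k\<close> \<open>3 * k < int m\<close> by simp
qed

theorem theorem2p7:
  fixes M :: "real measure" and m :: nat
  assumes "cantor4_measure M"
    and "m > 3" and "odd m" and "\<not> 3 dvd m"
  shows "((\<exists>r \<in> {-1, -2, 2, 3 :: int}. r mod int m \<in> G_subgroup m) \<longrightarrow> complete_number M m) \<and>
         (m > 12 \<and> (\<exists>r \<in> {5, 6, 7, 8, 9, 10, 11, 12 :: int}. r mod int m \<in> G_subgroup m)
            \<longrightarrow> complete_number M m)"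
proof -
  interpret cantor4 M using assms(1) by (rule cantor4_measureD)
  have "complete_number M m"
    if r: "r \<in> {-1, -2, 2, 3, 5, 6, 7, 8, 9, 10, 11, 12}" "r mod int m \<in> G_subgroup m" for r :: int
  proof (rule ccontr)
    assume "\<not> complete_number M m"
    then obtain t where "frame_limit m t < 1"
      using complete_number_if_frame_limit_ge_1[OF assms(3)] by (meson not_less)
    then obtain Z K where Z: "Z \<noteq> {}" "0 \<notin> Z" "\<And>k. k \<in> Z \<Longrightarrow> \<bar>k\<bar> \<le> K"
        "\<And>k. k \<in> Z \<Longrightarrow> \<exists>k'\<in>Z. 4 * k' = k \<or> 4 * k' = k + int m"
      using integer_orbit_if_frame_limit_less_1[OF assms(3)] by metis
    then obtain k0 where "k0 \<in> Z" by blast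
    \<comment> \<open>The orbit of \<open>k0\<close> under \<open>G_m\<close>. Any factor congruent
      to a power of 4 preserves it, which covers both 4 and \<open>r\<close>.\<close>
    define S where "S = range (\<lambda>j. 4 ^ j * k0 mod int m)"
    obtain i where i: "r mod int m = 4 ^ i mod int m" using r(2) by (auto simp: G_subgroup_def)
    have mult: "a * x mod int m \<in> S" if a: "a mod int m = 4 ^ i mod int m" and x: "x \<in> S" for a x i
    proof -
      obtain j where "x = 4 ^ j * k0 mod int m" using x S_def by blast
      then have "a * x mod int m = 4 ^ (i + j) * k0 mod int m"
        using a by (metis mod_mult_eq mod_mult_right_eq power_add mult.assoc)
      then show ?thesis by (simp add: S_def)
    qed
    show False
    proof (rule no_invariant_set_below_third[of S "int m" r])
      show "0 < x \<and> 3 * x < int m" if "x \<in> S" for x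
        using orbit_mod_in_third[OF assms(3,4) Z(2,3,4) \<open>k0 \<in> Z\<close>] that by (auto simp: S_def)
      show "4 * x mod int m \<in> S" if "x \<in> S" for x
        using mult[of 4 1 x] that by simp
      show "r * x mod int m \<in> S" if "x \<in> S" for x
        using mult[OF i that] .
    qed (use r S_def in auto)
  qed
  then show ?thesis by auto
qed

end
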